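(* Let $X$ be a completely regular space and let $H$ be a non-vanishing closed ideal in $C_B(X)$. The following are equivalent: (1) $\mathfrak{sp}(H)$ is locally connected. (2) For every closed subideal $G$ of $H$ there is a family $(G_i)_{i\in I}$ of indecomposable closed ideals of $C_B(X)$ such that \[G=\overline{\bigoplus_{i\in I}G_i},\] where the bar denotes the closure in $C_B(X)$.
   Context: Completely regular spaces are assumed to be Hausdorff. The scalar field $\mathbb{F}$ is either $\mathbb{R}$ or $\mathbb{C}$ and is fixed. For a space $X$, $C_B(X)$ is the Banach algebra of all bounded continuous mappings $X\to\mathbb{F}$ with pointwise addition and multiplication and the supremum norm. For completely regular $X$, $\beta X$ is the Stone–Čech compactification, and for $f\in C_B(X)$, $f_\beta$ denotes the unique continuous extension of $f$ to $\beta X$. The cozero-set of $f:Y\to\mathbb{F}$ is $\mathrm{Coz}(f)=\{y\in Y: f(y)\neq 0\}$. An ideal $H$ of $C_B(X)$ is non-vanishing if there is no point of $X$ at which every element of $H$ vanishes. For a non-vanishing closed ideal $H$, its spectrum is the subspace $\mathfrak{sp}(H)=\bigcup_{h\in H}\mathrm{Coz}(h_\beta)$ of $\beta X$. A subideal of $H$ is an ideal of $C_B(X)$ contained in $H$; a closed subideal is one that is closed in $C_B(X)$. Direct sums are internal. An ideal $G$ in a ring $R$ is indecomposable if $G\neq I\oplus J$ for any non-zero ideals $I$ and $J$ of $R$ (here $R=C_B(X)$). A space is locally connected if every neighborhood of any point contains a connected open neighborhood of that point. *)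

theory Defs
  imports "HOL-Analysis.Analysis" "HOL-Algebra.Ideal"
begin

(* keep the infix closure_of for topologies unambiguous *)
no_notation eq_closure_of (\<open>closure'_of\<index>\<close>)

section \<open>The ring of bounded continuous functions\<close>

text \<open>
  The underlying set is that of the library metric space \<open>cfunspace X euclidean_metric\<close>:
  bounded continuous functions on \<open>topspace X\<close>, made \<open>undefined\<close> outside \<open>topspace X\<close> so that
  functions agreeing on \<open>X\<close> are equal; its metric is the supremum metric.
  Since constants belong to the ring, its ring ideals are the same as its algebra ideals.
\<close>

definition CB :: "'a topology \<Rightarrow> ('a \<Rightarrow> 'k::real_normed_field) ring" where
  "CB X = \<lparr>carrier = mspace (cfunspace X euclidean_metric),
           mult = (\<lambda>f g. \<lambda>x\<in>topspace X. f x * g x),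
           one = (\<lambda>x\<in>topspace X. 1),
           zero = (\<lambda>x\<in>topspace X. 0),
           add = (\<lambda>f g. \<lambda>x\<in>topspace X. f x + g x)\<rparr>"

abbreviation CB_topology :: "'a topology \<Rightarrow> ('a \<Rightarrow> 'k::real_normed_field) topology" where
  "CB_topology X \<equiv> mtopology_of (cfunspace X euclidean_metric)"

definition closed_ideal :: "'a topology \<Rightarrow> ('a \<Rightarrow> 'k::real_normed_field) set \<Rightarrow> bool" where
  "closed_ideal X H \<longleftrightarrow> ideal H (CB X) \<and> closedin (CB_topology X) H"

definition nonvanishing :: "'a topology \<Rightarrow> ('a \<Rightarrow> 'k::zero) set \<Rightarrow> bool" where
  "nonvanishing X H \<longleftrightarrow> \<not> (\<exists>x\<in>topspace X. \<forall>h\<in>H. h x = 0)"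


section \<open>The Stone--Cech compactification\<close>

text \<open>
  The closure of the canonical image of \<open>X\<close> in the cube indexed by all continuous functions
  from \<open>X\<close> to the unit interval. The lemmas \<open>compact_space_stone_cech\<close>,
  \<open>Hausdorff_space_stone_cech\<close>, \<open>embedding_map_stone_cech\<close>, \<open>dense_stone_cech\<close> and
  \<open>stone_cech_extension\<close> below give its characteristic properties.
\<close>

definition cube_index :: "'a topology \<Rightarrow> ('a \<Rightarrow> real) set" where
  "cube_index X = mspace (submetric (cfunspace X euclidean_metric) {f. f \<in> topspace X \<rightarrow> {0..1}})"

definition cube :: "'a topology \<Rightarrow> (('a \<Rightarrow> real) \<Rightarrow> real) topology" where
  "cube X = product_topology (\<lambda>f. top_of_set {0..1::real}) (cube_index X)"

definition stone_cech_embed :: "'a topology \<Rightarrow> 'a \<Rightarrow> (('a \<Rightarrow> real) \<Rightarrow> real)" where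
  "stone_cech_embed X x = (\<lambda>f\<in>cube_index X. f x)"

definition stone_cech :: "'a topology \<Rightarrow> (('a \<Rightarrow> real) \<Rightarrow> real) topology" where
  "stone_cech X = subtopology (cube X) (cube X closure_of (stone_cech_embed X ` topspace X))"

text \<open>The unique continuous extension of \<open>f\<close>, again \<open>undefined\<close> off the space.\<close>

definition stone_cech_ext ::
    "'a topology \<Rightarrow> ('a \<Rightarrow> 'k::topological_space) \<Rightarrow> (('a \<Rightarrow> real) \<Rightarrow> real) \<Rightarrow> 'k" where
  "stone_cech_ext X f =
     (THE g. g \<in> extensional (topspace (stone_cech X)) \<and>
             continuous_map (stone_cech X) euclidean g \<and>
             (\<forall>x\<in>topspace X. g (stone_cech_embed X x) = f x))"

definition Coz :: "'b topology \<Rightarrow> ('b \<Rightarrow> 'k::zero) \<Rightarrow> 'b set" where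
  "Coz Y f = {y \<in> topspace Y. f y \<noteq> 0}"

definition spectrum ::
    "'a topology \<Rightarrow> ('a \<Rightarrow> 'k::{topological_space,zero}) set \<Rightarrow> (('a \<Rightarrow> real) \<Rightarrow> real) topology" where
  "spectrum X H =
     subtopology (stone_cech X) (\<Union>h\<in>H. Coz (stone_cech X) (stone_cech_ext X h))"


section \<open>Internal direct sums of ideals\<close>

text \<open>
  Non-zero members of a family whose sum is direct are pairwise distinct, so, up to repeated zero
  ideals, every such family can be indexed by the set of its members. Existence of a family of
  ideals of \<open>R\<close> with direct sum \<open>S\<close> may therefore be stated with index sets of type
  \<open>'a set set\<close>, where \<open>'a\<close> is the type of elements of \<open>R\<close>.
\<close>

definition indecomposable_ideal :: "'a set \<Rightarrow> ('a, 'm) ring_scheme \<Rightarrow> bool" where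
  "indecomposable_ideal G R \<longleftrightarrow>
     ideal G R \<and>
     \<not> (\<exists>I J. ideal I R \<and> ideal J R \<and> I \<noteq> {\<zero>\<^bsub>R\<^esub>} \<and> J \<noteq> {\<zero>\<^bsub>R\<^esub>} \<and>
              I \<inter> J = {\<zero>\<^bsub>R\<^esub>} \<and> G = I <+>\<^bsub>R\<^esub> J)"

definition ideal_sum :: "('a, 'm) ring_scheme \<Rightarrow> 'i set \<Rightarrow> ('i \<Rightarrow> 'a set) \<Rightarrow> 'a set" where
  "ideal_sum R I G = {finsum R x F | F x. finite F \<and> F \<subseteq> I \<and> x \<in> (\<Pi> i\<in>F. G i)}"

definition is_internal_direct_sum ::
    "('a, 'm) ring_scheme \<Rightarrow> 'i set \<Rightarrow> ('i \<Rightarrow> 'a set) \<Rightarrow> 'a set \<Rightarrow> bool" where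
  "is_internal_direct_sum R I G S \<longleftrightarrow>
     S = ideal_sum R I G \<and> (\<forall>i\<in>I. G i \<inter> ideal_sum R (I - {i}) G = {\<zero>\<^bsub>R\<^esub>})"


section \<open>Basic facts\<close>

lemma carrier_CB:
  "f \<in> carrier (CB X) \<longleftrightarrow>
     f \<in> extensional (topspace X) \<and> bounded (f ` topspace X) \<and> continuous_map X euclidean f"
  by (auto simp: CB_def)

lemma cring_CB: "cring (CB X :: ('a \<Rightarrow> 'k::real_normed_field) ring)"
proof -
  have bd: "bounded ((\<lambda>x. f x + g x) ` S)" "bounded ((\<lambda>x. f x * g x) ` S)"
    if bdd: "bounded (f ` S)" "bounded (g ` S)" for f g :: "'a \<Rightarrow> 'k" and S
  proof -
    obtain a where a: "\<And>x. x \<in> S \<Longrightarrow> norm (f x) \<le> a"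
      using bdd(1) unfolding bounded_iff by (metis imageI)
    obtain b where b: "\<And>x. x \<in> S \<Longrightarrow> norm (g x) \<le> b"
      using bdd(2) unfolding bounded_iff by (metis imageI)
    show "bounded ((\<lambda>x. f x + g x) ` S)"
      unfolding bounded_iff using a b by (auto intro!: exI[of _ "a + b"] norm_triangle_mono)
    have "norm (f x * g x) \<le> a * b" if "x \<in> S" for x
      using a[OF that] b[OF that] by (simp add: norm_mult mult_mono')
    then show "bounded ((\<lambda>x. f x * g x) ` S)"
      unfolding bounded_iff by blast
  qed
  have add: "(\<lambda>x\<in>topspace X. f x + g x) \<in> carrier (CB X)"
   and mult: "(\<lambda>x\<in>topspace X. f x * g x) \<in> carrier (CB X)"
    if "f \<in> carrier (CB X)" "g \<in> carrier (CB X)" for f g :: "'a \<Rightarrow> 'k"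
  proof -
    have "continuous_map X euclidean (\<lambda>x. f x + g x)"
      using that unfolding carrier_CB
      by (simp add: continuous_map_atin tendsto_add)
    moreover have "continuous_map X euclidean (\<lambda>x. f x * g x)"
      using that unfolding carrier_CB
      by (simp add: continuous_map_atin tendsto_mult)
    ultimately show "(\<lambda>x\<in>topspace X. f x + g x) \<in> carrier (CB X)"
       "(\<lambda>x\<in>topspace X. f x * g x) \<in> carrier (CB X)"
      using that bd[of f "topspace X" g] unfolding carrier_CB
      by (auto elim!: continuous_map_eq)
  qed
  have const: "(\<lambda>x\<in>topspace X. c) \<in> carrier (CB X)" for c :: 'k
    unfolding carrier_CB by (auto simp: bounded_iff)
  have ext: "f \<in> extensional (topspace X)" if "f \<in> carrier (CB X)" for f :: "'a \<Rightarrow> 'k"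
    using that by (simp add: carrier_CB)
  note ops = add mult const
  show ?thesis
  proof (rule cringI)
    show "abelian_group (CB X :: ('a \<Rightarrow> 'k) ring)"
    proof (rule abelian_groupI)
      fix f :: "'a \<Rightarrow> 'k" assume f: "f \<in> carrier (CB X)"
      then have "(\<lambda>x\<in>topspace X. (\<lambda>x\<in>topspace X. -1) x * f x) \<in> carrier (CB X)"
        using ops by blast
      then show "\<exists>g\<in>carrier (CB X). g \<oplus>\<^bsub>CB X\<^esub> f = \<zero>\<^bsub>CB X\<^esub>"
        by (rule bexI[rotated]) (auto simp: CB_def fun_eq_iff)
      show "\<zero>\<^bsub>CB X\<^esub> \<oplus>\<^bsub>CB X\<^esub> f = f"
        using ext[OF f] by (auto simp: CB_def fun_eq_iff extensional_def)
    qed (use ops in \<open>auto simp: CB_def fun_eq_iff\<close>)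
    show "comm_monoid (CB X :: ('a \<Rightarrow> 'k) ring)"
    proof (rule comm_monoidI)
      fix f :: "'a \<Rightarrow> 'k" assume f: "f \<in> carrier (CB X)"
      show "\<one>\<^bsub>CB X\<^esub> \<otimes>\<^bsub>CB X\<^esub> f = f"
        using ext[OF f] by (auto simp: CB_def fun_eq_iff extensional_def)
    qed (use ops in \<open>auto simp: CB_def fun_eq_iff\<close>)
  qed (auto simp: CB_def fun_eq_iff algebra_simps)
qed

lemma Hausdorff_space_cube: "Hausdorff_space (cube X)"
  unfolding cube_def
  using Hausdorff_space_euclidean Hausdorff_space_product_topology Hausdorff_space_subtopology
  by blast

lemma compact_space_cube: "compact_space (cube X)"
  unfolding cube_def
  using compact_space_product_topology compact_space_subtopology compactin_euclidean_iff by blast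

lemma compact_space_stone_cech: "compact_space (stone_cech X)"
  unfolding stone_cech_def
  by (simp add: closedin_compact_space compact_space_cube compact_space_subtopology)

lemma Hausdorff_space_stone_cech: "Hausdorff_space (stone_cech X)"
  unfolding stone_cech_def by (simp add: Hausdorff_space_cube Hausdorff_space_subtopology)

lemma stone_cech_embed_in_cube: "stone_cech_embed X ` topspace X \<subseteq> topspace (cube X)"
  by (auto simp: stone_cech_embed_def cube_def cube_index_def PiE_def Pi_iff)

lemma embed_subset_closure:
  "stone_cech_embed X ` topspace X \<subseteq> cube X closure_of (stone_cech_embed X ` topspace X)"
  by (rule closure_of_subset[OF stone_cech_embed_in_cube])

lemma topspace_stone_cech:
  "topspace (stone_cech X) = cube X closure_of (stone_cech_embed X ` topspace X)"
  by (simp add: stone_cech_def closure_of_subset_topspace inf.absorb2)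

lemma embedding_map_stone_cech:
  assumes "completely_regular_space X" "Hausdorff_space X"
  shows "embedding_map X (stone_cech X) (stone_cech_embed X)"
proof -
  have "embedding_map X (cube X) (stone_cech_embed X)"
    using completely_regular_space_cube_embedding_explicit[OF assms]
    unfolding cube_def cube_index_def stone_cech_embed_def by simp
  then show ?thesis
    unfolding stone_cech_def embedding_map_in_subtopology
    using embed_subset_closure by (rule conjI)
qed

lemma dense_stone_cech:
  "stone_cech X closure_of (stone_cech_embed X ` topspace X) = topspace (stone_cech X)"
proof -
  let ?A = "stone_cech_embed X ` topspace X"
  let ?C = "cube X closure_of ?A"
  have "stone_cech X closure_of ?A = ?C \<inter> cube X closure_of (?C \<inter> ?A)"
    unfolding stone_cech_def by (rule closure_of_subtopology)
  also have "?C \<inter> ?A = ?A"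
    using embed_subset_closure by (rule inf.absorb2)
  finally show ?thesis
    unfolding topspace_stone_cech by (simp only: inf.idem)
qed

lemma stone_cech_extension_real:
  fixes f :: "'a \<Rightarrow> real"
  assumes "bounded (f ` topspace X)" "continuous_map X euclidean f"
  shows "\<exists>g. continuous_map (stone_cech X) euclidean g \<and>
             (\<forall>x\<in>topspace X. g (stone_cech_embed X x) = f x)"
proof -
  obtain B0 where B0: "\<And>x. x \<in> topspace X \<Longrightarrow> \<bar>f x\<bar> \<le> B0"
    using assms(1) by (auto simp: bounded_iff)
  define B where "B = max 1 B0"
  have B: "B > 0" "\<And>x. x \<in> topspace X \<Longrightarrow> \<bar>f x\<bar> \<le> B"
    using B0 unfolding B_def by force+
  define u where "u = (\<lambda>x\<in>topspace X. (f x + B) / (2 * B))"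
  have u01: "u x \<in> {0..1}" if "x \<in> topspace X" for x
    using B(1) B(2)[OF that] that by (auto simp: u_def field_simps abs_le_iff)
  have "bounded (u ` topspace X)"
    by (rule bounded_subset[of "{0..1}"]) (use u01 in auto)
  moreover have "continuous_map X euclidean (\<lambda>x. (f x + B) / (2 * B))"
    using assms(2) B(1) by (intro continuous_intros) auto
  then have "continuous_map X euclidean u"
    by (rule continuous_map_eq) (simp add: u_def)
  ultimately have u: "u \<in> cube_index X"
    using u01 by (auto simp: cube_index_def u_def)
  have "continuous_map (cube X) (top_of_set {0..1}) (\<lambda>y. y u)"
    unfolding cube_def using u by (rule continuous_map_product_projection)
  then have pr: "continuous_map (stone_cech X) euclidean (\<lambda>y. y u)"
    unfolding stone_cech_def
    by (meson continuous_map_from_subtopology continuous_map_in_subtopology)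
  have "continuous_map (stone_cech X) euclidean (\<lambda>y. 2 * B * y u - B)"
    by (intro continuous_intros pr) auto
  moreover have "2 * B * stone_cech_embed X x u - B = f x" if "x \<in> topspace X" for x
    using u that B(1) by (simp add: stone_cech_embed_def u_def)
  ultimately show ?thesis by blast
qed

lemma stone_cech_extension:
  fixes f :: "'a \<Rightarrow> 'k::euclidean_space"
  assumes "bounded (f ` topspace X)" "continuous_map X euclidean f"
  shows "\<exists>!g. g \<in> extensional (topspace (stone_cech X)) \<and>
              continuous_map (stone_cech X) euclidean g \<and>
              (\<forall>x\<in>topspace X. g (stone_cech_embed X x) = f x)"
proof -
  have "\<exists>g. continuous_map (stone_cech X) euclidean g \<and>
             (\<forall>x\<in>topspace X. g (stone_cech_embed X x) = f x \<bullet> b)" for b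
  proof (rule stone_cech_extension_real)
    show "bounded ((\<lambda>x. f x \<bullet> b) ` topspace X)"
      using bounded_linear_image[OF assms(1) bounded_linear_inner_left, of b]
      by (simp add: image_image)
    show "continuous_map X euclidean (\<lambda>x. f x \<bullet> b)"
      using assms(2) by (simp add: continuous_map_atin tendsto_inner)
  qed
  then obtain g where g: "\<And>b. continuous_map (stone_cech X) euclidean (g b)"
    and gf: "\<And>b x. x \<in> topspace X \<Longrightarrow> g b (stone_cech_embed X x) = f x \<bullet> b"
    by metis
  define h where "h = (\<lambda>y\<in>topspace (stone_cech X). \<Sum>b\<in>Basis. g b y *\<^sub>R b)"
  have "continuous_map (stone_cech X) euclidean (\<lambda>y. \<Sum>b\<in>Basis. g b y *\<^sub>R b)"
    using g by (simp add: continuous_map_atin tendsto_sum tendsto_scaleR)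
  then have 1: "continuous_map (stone_cech X) euclidean h"
    by (rule continuous_map_eq) (simp add: h_def)
  have 2: "h (stone_cech_embed X x) = f x" if "x \<in> topspace X" for x
  proof -
    have "stone_cech_embed X x \<in> topspace (stone_cech X)"
      using that embed_subset_closure[of X] by (auto simp: topspace_stone_cech)
    then show ?thesis
      by (simp add: h_def gf that euclidean_representation)
  qed
  show ?thesis
  proof (rule ex1I[of _ h])
    show "h \<in> extensional (topspace (stone_cech X)) \<and>
          continuous_map (stone_cech X) euclidean h \<and>
          (\<forall>x\<in>topspace X. h (stone_cech_embed X x) = f x)"
      using 1 2 by (simp add: h_def)
  next
    fix k
    assume k: "k \<in> extensional (topspace (stone_cech X)) \<and>
               continuous_map (stone_cech X) euclidean k \<and>
               (\<forall>x\<in>topspace X. k (stone_cech_embed X x) = f x)"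
    have "k y = h y" if "y \<in> topspace (stone_cech X)" for y
    proof (rule forall_in_closure_of_eq[OF _ Hausdorff_space_euclidean, of y "stone_cech X"
          "stone_cech_embed X ` topspace X"])
      show "y \<in> stone_cech X closure_of (stone_cech_embed X ` topspace X)"
        using that by (simp only: dense_stone_cech)
    qed (use 1 2 k in auto)
    then show "k = h"
      using k by (auto intro!: extensionalityI[of _ "topspace (stone_cech X)"] simp: h_def)
  qed
qed

end

theory Submission
  imports Defs
begin

text \<open>
  Write \<open>K\<close> for the Stone--Cech compactification of \<open>X\<close>. Extension and restriction identify
  \<open>CB X\<close> isometrically with the ring of all continuous functions on the compact Hausdorff space
  \<open>K\<close>. An ideal \<open>G\<close> determines the open subset \<open>ideal_coz X G\<close> of \<open>K\<close> on which it does not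
  vanish; for \<open>G = H\<close> this is the spectrum. The theorem holds because this passage turns algebra
  into topology. Two ideals meet only in zero exactly when their open sets are disjoint
  (\<open>disjoint_ideals_iff\<close>), so a sum of ideals is direct exactly when their open sets form a
  disjoint family (\<open>is_internal_direct_sum_CB_iff\<close>); the open set of a sum is the union of the
  open sets (\<open>ideal_coz_ideal_sum\<close>), and taking closures does not change it
  (\<open>ideal_coz_closure_of\<close>). Finally, a closed ideal is indecomposable exactly when its open set is
  connected (\<open>indecomposable_ideal_iff_connectedin\<close>).

  If the spectrum is locally connected and \<open>G\<close> is a closed subideal, then the components of
  \<open>ideal_coz X G\<close> are open, and the parts of \<open>G\<close> supported in the single components are the
  required summands. Their sum is dense in \<open>G\<close> because, for \<open>f\<close> in \<open>G\<close> and \<open>e > 0\<close>, the set where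
  \<open>norm f \<ge> e\<close> is compact and thus meets only finitely many components
  (\<open>closure_of_sum_of_parts\<close>). Conversely, an open subset \<open>U\<close> of the spectrum is the open set of
  the part of \<open>H\<close> supported in \<open>U\<close>, by Urysohn's lemma, and a decomposition of this ideal
  partitions \<open>U\<close> into connected open sets.

  The one analytic step, needed in both directions, is that a function in a closed ideal \<open>G\<close> whose
  cozero set splits into two disjoint open pieces can be restricted to one of the pieces without
  leaving \<open>G\<close> (\<open>restrict_to_clopen_part\<close>).

  Everything is proved for a scalar field that is both a normed field and a Euclidean space, which
  covers the reals and the complex numbers at once.
\<close>

section \<open>Bounded continuous functions and their extensions\<close>

lemma stone_cech_embed_in_topspace:
  "x \<in> topspace X \<Longrightarrow> stone_cech_embed X x \<in> topspace (stone_cech X)"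
  using embed_subset_closure[of X] by (auto simp: topspace_stone_cech)

lemma continuous_map_stone_cech_embed:
  "continuous_map X (stone_cech X) (stone_cech_embed X)"
proof -
  have "continuous_map X (top_of_set {0..1}) (\<lambda>x. stone_cech_embed X x f)"
    if f: "f \<in> cube_index X" for f
  proof -
    have "continuous_map X euclidean f" "f \<in> topspace X \<rightarrow> {0..1}"
      using f by (auto simp: cube_index_def)
    then show ?thesis
      using f by (simp add: stone_cech_embed_def continuous_map_in_subtopology)
  qed
  then have "continuous_map X (cube X) (stone_cech_embed X)"
    unfolding cube_def
    by (subst continuous_map_componentwise) (auto simp: stone_cech_embed_def extensional_def)
  then show ?thesis
    unfolding stone_cech_def continuous_map_in_subtopology
    using embed_subset_closure[of X] by blast
qed

lemma stone_cech_ext: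
  fixes f :: "'a \<Rightarrow> 'k::{real_normed_field,euclidean_space}"
  assumes "f \<in> carrier (CB X)"
  shows continuous_map_stone_cech_ext: "continuous_map (stone_cech X) euclidean (stone_cech_ext X f)"
    and stone_cech_ext_embed: "x \<in> topspace X \<Longrightarrow> stone_cech_ext X f (stone_cech_embed X x) = f x"
  using theI'[OF stone_cech_extension, of f X] assms
  unfolding stone_cech_ext_def[symmetric] carrier_CB by blast+

lemma stone_cech_ext_eqI:
  fixes f :: "'a \<Rightarrow> 'k::{real_normed_field,euclidean_space}"
  assumes f: "f \<in> carrier (CB X)" and "continuous_map (stone_cech X) euclidean g"
    and "\<And>x. x \<in> topspace X \<Longrightarrow> g (stone_cech_embed X x) = f x"
    and "y \<in> topspace (stone_cech X)"
  shows "stone_cech_ext X f y = g y"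
proof (rule forall_in_closure_of_eq[OF _ Hausdorff_space_euclidean, of y "stone_cech X"
      "stone_cech_embed X ` topspace X"])
  show "y \<in> stone_cech X closure_of (stone_cech_embed X ` topspace X)"
    using assms by (simp only: dense_stone_cech)
qed (use assms continuous_map_stone_cech_ext[OF f] stone_cech_ext_embed[OF f] in auto)

text \<open>
  Extension preserves uniform distance, since the image of \<open>X\<close> is dense. Hence uniform
  approximation in \<open>CB X\<close> may be tested on the compactification.
\<close>

lemma stone_cech_ext_dist_le:
  fixes f g :: "'a \<Rightarrow> 'k::{real_normed_field,euclidean_space}"
  assumes f: "f \<in> carrier (CB X)" and g: "g \<in> carrier (CB X)"
  shows "(\<forall>x\<in>topspace X. dist (f x) (g x) \<le> e) \<longleftrightarrow>
    (\<forall>y\<in>topspace (stone_cech X). dist (stone_cech_ext X f y) (stone_cech_ext X g y) \<le> e)"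
    (is "?L \<longleftrightarrow> ?R")
proof
  assume L: ?L
  show ?R
  proof
    fix y assume y: "y \<in> topspace (stone_cech X)"
    show "dist (stone_cech_ext X f y) (stone_cech_ext X g y) \<le> e"
    proof (rule forall_in_closure_of[of y "stone_cech X" "stone_cech_embed X ` topspace X"])
      show "y \<in> stone_cech X closure_of (stone_cech_embed X ` topspace X)"
        using y by (simp only: dense_stone_cech)
      have "continuous_map (stone_cech X) euclideanreal
              (\<lambda>y. dist (stone_cech_ext X f y) (stone_cech_ext X g y))"
        using continuous_map_stone_cech_ext[OF f] continuous_map_stone_cech_ext[OF g]
        by (simp add: continuous_map_atin tendsto_dist)
      then have "closedin (stone_cech X) {y \<in> topspace (stone_cech X).
          dist (stone_cech_ext X f y) (stone_cech_ext X g y) \<in> {..e}}"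
        by (rule closedin_continuous_map_preimage) auto
      then show "closedin (stone_cech X) {y \<in> topspace (stone_cech X).
          dist (stone_cech_ext X f y) (stone_cech_ext X g y) \<le> e}"
        by simp
    qed (use L f g in \<open>auto simp: stone_cech_ext_embed\<close>)
  qed
next
  assume ?R
  then show ?L
    using stone_cech_ext_embed[OF f] stone_cech_ext_embed[OF g] stone_cech_embed_in_topspace
    by metis
qed

lemma CB_eqI:
  fixes f g :: "'a \<Rightarrow> 'k::{real_normed_field,euclidean_space}"
  assumes f: "f \<in> carrier (CB X)" and g: "g \<in> carrier (CB X)"
    and "\<And>y. y \<in> topspace (stone_cech X) \<Longrightarrow> stone_cech_ext X f y = stone_cech_ext X g y"
  shows "f = g"
proof (rule extensionalityI)
  show "f \<in> extensional (topspace X)" "g \<in> extensional (topspace X)"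
    using f g by (simp_all add: carrier_CB)
  show "f x = g x" if "x \<in> topspace X" for x
    using that assms stone_cech_ext_embed stone_cech_embed_in_topspace by metis
qed

text \<open>
  Every continuous function on the compactification comes from \<open>CB X\<close>. This is how Urysohn functions
  and cut-offs built on the compact space become multipliers in the ring.
\<close>

lemma CB_pullback:
  fixes \<phi> :: "_ \<Rightarrow> 'k::{real_normed_field,euclidean_space}"
  assumes "continuous_map (stone_cech X) euclidean \<phi>"
  obtains f where "f \<in> carrier (CB X)"
    and "\<And>y. y \<in> topspace (stone_cech X) \<Longrightarrow> stone_cech_ext X f y = \<phi> y"
proof
  let ?f = "\<lambda>x\<in>topspace X. \<phi> (stone_cech_embed X x)"
  have "compact (\<phi> ` topspace (stone_cech X))"
    using image_compactin[OF _ assms] compact_space_stone_cech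
    by (auto simp: compact_space_def)
  then have "bounded (\<phi> ` topspace (stone_cech X))"
    by (rule compact_imp_bounded)
  then have "bounded (?f ` topspace X)"
    by (rule bounded_subset) (auto simp: stone_cech_embed_in_topspace)
  moreover have "continuous_map X euclidean ?f"
    using continuous_map_compose[OF continuous_map_stone_cech_embed assms]
    by (rule continuous_map_eq) simp
  ultimately show *: "?f \<in> carrier (CB X)"
    by (simp add: carrier_CB)
  show "stone_cech_ext X ?f y = \<phi> y" if "y \<in> topspace (stone_cech X)" for y
    using * assms _ that by (rule stone_cech_ext_eqI) simp
qed

lemma stone_cech_ext_zero:
  fixes X :: "'a topology"
  assumes "y \<in> topspace (stone_cech X)"
  shows "stone_cech_ext X (\<zero>\<^bsub>CB X\<^esub> :: 'a \<Rightarrow> 'k::{real_normed_field,euclidean_space}) y = 0"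
  by (rule stone_cech_ext_eqI[OF cring.cring_simprules(2)[OF cring_CB]])
    (use assms in \<open>auto simp: CB_def\<close>)

lemma stone_cech_ext_add:
  fixes f g :: "'a \<Rightarrow> 'k::{real_normed_field,euclidean_space}"
  assumes f: "f \<in> carrier (CB X)" and g: "g \<in> carrier (CB X)" and y: "y \<in> topspace (stone_cech X)"
  shows "stone_cech_ext X (f \<oplus>\<^bsub>CB X\<^esub> g) y = stone_cech_ext X f y + stone_cech_ext X g y"
proof (rule stone_cech_ext_eqI[OF cring.cring_simprules(1)[OF cring_CB f g] _ _ y])
  show "continuous_map (stone_cech X) euclidean (\<lambda>y. stone_cech_ext X f y + stone_cech_ext X g y)"
    using continuous_map_stone_cech_ext[OF f] continuous_map_stone_cech_ext[OF g]
    by (simp add: continuous_map_atin tendsto_add)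
qed (use stone_cech_ext_embed[OF f] stone_cech_ext_embed[OF g] in \<open>simp add: CB_def\<close>)

lemma stone_cech_ext_mult:
  fixes f g :: "'a \<Rightarrow> 'k::{real_normed_field,euclidean_space}"
  assumes f: "f \<in> carrier (CB X)" and g: "g \<in> carrier (CB X)" and y: "y \<in> topspace (stone_cech X)"
  shows "stone_cech_ext X (f \<otimes>\<^bsub>CB X\<^esub> g) y = stone_cech_ext X f y * stone_cech_ext X g y"
proof (rule stone_cech_ext_eqI[OF cring.cring_simprules(5)[OF cring_CB f g] _ _ y])
  show "continuous_map (stone_cech X) euclidean (\<lambda>y. stone_cech_ext X f y * stone_cech_ext X g y)"
    using continuous_map_stone_cech_ext[OF f] continuous_map_stone_cech_ext[OF g]
    by (simp add: continuous_map_atin tendsto_mult)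
qed (use stone_cech_ext_embed[OF f] stone_cech_ext_embed[OF g] in \<open>simp add: CB_def\<close>)

lemma in_closure_of_CB_iff:
  fixes S :: "('a \<Rightarrow> 'k::{real_normed_field,euclidean_space}) set"
  assumes "S \<subseteq> carrier (CB X)"
  shows "f \<in> CB_topology X closure_of S \<longleftrightarrow> f \<in> carrier (CB X) \<and>
    (\<forall>e>0. \<exists>g\<in>S. \<forall>y\<in>topspace (stone_cech X).
        dist (stone_cech_ext X f y) (stone_cech_ext X g y) \<le> e)"
proof -
  let ?m = "cfunspace X euclidean_metric :: ('a \<Rightarrow> 'k) metric"
  have carr: "mspace ?m = carrier (CB X)"
    by (simp add: CB_def)
  interpret Metric_space "mspace ?m" "mdist ?m"
    by (rule Metric_space_mspace_mdist)
  have le: "mdist ?m f g \<le> e \<longleftrightarrow> (\<forall>y\<in>topspace (stone_cech X).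
        dist (stone_cech_ext X f y) (stone_cech_ext X g y) \<le> e)"
    if "f \<in> carrier (CB X)" "g \<in> carrier (CB X)" "e > 0" for f g e
    using mdist_cfunspace_le[of e X euclidean_metric f g]
      mdist_cfunspace_imp_mdist_le[of f X euclidean_metric g e] that
    unfolding stone_cech_ext_dist_le[OF that(1,2), symmetric] carr by auto
  have "f \<in> CB_topology X closure_of S \<longleftrightarrow>
      f \<in> mspace ?m \<and> (\<forall>e>0. \<exists>g\<in>S. f \<in> mspace ?m \<and> g \<in> mspace ?m \<and> mdist ?m f g \<le> e)"
    unfolding mtopology_of_def metric_closure_of_alt mem_Collect_eq in_mcball by (rule refl)
  also have "\<dots> \<longleftrightarrow> f \<in> carrier (CB X) \<and> (\<forall>e>0. \<exists>g\<in>S. mdist ?m f g \<le> e)"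
    unfolding carr using assms by (metis subset_iff)
  also have "\<dots> \<longleftrightarrow> f \<in> carrier (CB X) \<and> (\<forall>e>0. \<exists>g\<in>S. \<forall>y\<in>topspace (stone_cech X).
        dist (stone_cech_ext X f y) (stone_cech_ext X g y) \<le> e)"
    using assms by (meson le subset_iff)
  finally show ?thesis .
qed

lemma ideal_CB_I:
  fixes I :: "('a \<Rightarrow> 'k::real_normed_field) set"
  assumes sub: "I \<subseteq> carrier (CB X)" and zero: "\<zero>\<^bsub>CB X\<^esub> \<in> I"
    and add: "\<And>f g. f \<in> I \<Longrightarrow> g \<in> I \<Longrightarrow> f \<oplus>\<^bsub>CB X\<^esub> g \<in> I"
    and mult: "\<And>f g. f \<in> I \<Longrightarrow> g \<in> carrier (CB X) \<Longrightarrow> g \<otimes>\<^bsub>CB X\<^esub> f \<in> I"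
  shows "ideal I (CB X)"
proof -
  interpret cring "CB X :: ('a \<Rightarrow> 'k) ring" by (rule cring_CB)
  show ?thesis
  proof (rule idealI)
    show "subgroup I (add_monoid (CB X))"
    proof (rule add.subgroupI)
      fix f assume f: "f \<in> I"
      have "\<ominus>\<^bsub>CB X\<^esub> f = (\<ominus>\<^bsub>CB X\<^esub> \<one>\<^bsub>CB X\<^esub>) \<otimes>\<^bsub>CB X\<^esub> f"
        using f sub by (simp add: l_minus subset_iff)
      then show "\<ominus>\<^bsub>CB X\<^esub> f \<in> I"
        using mult[OF f] by simp
    qed (use sub zero add in auto)
    show "g \<otimes>\<^bsub>CB X\<^esub> f \<in> I" "f \<otimes>\<^bsub>CB X\<^esub> g \<in> I" if "f \<in> I" "g \<in> carrier (CB X)" for f g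
      using mult[OF that] m_comm[of f g] that sub by auto
  qed (rule ring_axioms)
qed

lemma ideal_subset_CB: "ideal I (CB X) \<Longrightarrow> I \<subseteq> carrier (CB X)"
  by (simp add: additive_subgroup.a_subset ideal.axioms(1))

lemma ideal_zero_CB: "ideal I (CB X) \<Longrightarrow> \<zero>\<^bsub>CB X\<^esub> \<in> I"
  by (simp add: additive_subgroup.zero_closed ideal.axioms(1))

lemma ideal_add_CB: "ideal I (CB X) \<Longrightarrow> f \<in> I \<Longrightarrow> g \<in> I \<Longrightarrow> f \<oplus>\<^bsub>CB X\<^esub> g \<in> I"
  by (simp add: additive_subgroup.a_closed ideal.axioms(1))

section \<open>The open set of an ideal\<close>

text \<open>
  By definition this is the underlying set of the spectrum; it is named as a subset of the
  compactification because it is used for all ideals, inside that fixed space.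
\<close>

definition ideal_coz ::
    "'a topology \<Rightarrow> ('a \<Rightarrow> 'k::{topological_space,zero}) set \<Rightarrow> (('a \<Rightarrow> real) \<Rightarrow> real) set" where
  "ideal_coz X G = (\<Union>g\<in>G. Coz (stone_cech X) (stone_cech_ext X g))"

definition ideal_part ::
    "'a topology \<Rightarrow> ('a \<Rightarrow> 'k::{topological_space,zero}) set \<Rightarrow> (('a \<Rightarrow> real) \<Rightarrow> real) set
      \<Rightarrow> ('a \<Rightarrow> 'k) set" where
  "ideal_part X G U = {f \<in> G. Coz (stone_cech X) (stone_cech_ext X f) \<subseteq> U}"

lemma in_ideal_coz:
  "y \<in> ideal_coz X G \<longleftrightarrow> y \<in> topspace (stone_cech X) \<and> (\<exists>g\<in>G. stone_cech_ext X g y \<noteq> 0)"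
  by (auto simp: ideal_coz_def Coz_def)

lemma in_ideal_part:
  "f \<in> ideal_part X G U \<longleftrightarrow>
     f \<in> G \<and> (\<forall>y\<in>topspace (stone_cech X) - U. stone_cech_ext X f y = 0)"
  by (auto simp: ideal_part_def Coz_def)

lemma ideal_coz_subset_topspace: "ideal_coz X G \<subseteq> topspace (stone_cech X)"
  by (auto simp: in_ideal_coz)

lemma openin_ideal_coz:
  fixes G :: "('a \<Rightarrow> 'k::{real_normed_field,euclidean_space}) set"
  assumes "G \<subseteq> carrier (CB X)"
  shows "openin (stone_cech X) (ideal_coz X G)"
  unfolding ideal_coz_def
proof (rule openin_Union, clarify)
  fix g assume "g \<in> G"
  then have "openin (stone_cech X) {y \<in> topspace (stone_cech X). stone_cech_ext X g y \<in> - {0}}"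
    using assms continuous_map_stone_cech_ext by (intro openin_continuous_map_preimage) auto
  then show "openin (stone_cech X) (Coz (stone_cech X) (stone_cech_ext X g))"
    by (simp add: Coz_def)
qed

lemma ideal_coz_eq_empty_iff:
  fixes G :: "('a \<Rightarrow> 'k::{real_normed_field,euclidean_space}) set"
  assumes sub: "G \<subseteq> carrier (CB X)" and zero: "\<zero>\<^bsub>CB X\<^esub> \<in> G"
  shows "ideal_coz X G = {} \<longleftrightarrow> G = {\<zero>\<^bsub>CB X\<^esub>}"
proof
  assume e: "ideal_coz X G = {}"
  have "g = \<zero>\<^bsub>CB X\<^esub>" if "g \<in> G" for g
  proof (rule CB_eqI)
    show "g \<in> carrier (CB X)" "(\<zero>\<^bsub>CB X\<^esub> :: 'a \<Rightarrow> 'k) \<in> carrier (CB X)"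
      using that sub zero by auto
    show "stone_cech_ext X g y = stone_cech_ext X \<zero>\<^bsub>CB X\<^esub> y"
      if "y \<in> topspace (stone_cech X)" for y
    proof -
      have "y \<notin> ideal_coz X G"
        using e by simp
      then have "stone_cech_ext X g y = 0"
        using that \<open>g \<in> G\<close> by (simp add: in_ideal_coz)
      then show ?thesis
        by (simp add: stone_cech_ext_zero that)
    qed
  qed
  then show "G = {\<zero>\<^bsub>CB X\<^esub>}"
    using zero by blast
qed (auto simp: in_ideal_coz stone_cech_ext_zero)

text \<open>
  If \<open>f\<close> in \<open>I\<close> and \<open>g\<close> in \<open>J\<close> are both non-zero at a point, then so is \<open>f g\<close>, which lies in
  \<open>I \<inter> J\<close>; conversely a non-zero member of \<open>I \<inter> J\<close> is non-zero at a point of both open sets.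
\<close>

lemma disjoint_ideals_iff:
  fixes I J :: "('a \<Rightarrow> 'k::{real_normed_field,euclidean_space}) set"
  assumes I: "ideal I (CB X)" and J: "ideal J (CB X)"
  shows "I \<inter> J = {\<zero>\<^bsub>CB X\<^esub>} \<longleftrightarrow> ideal_coz X I \<inter> ideal_coz X J = {}"
proof
  assume IJ: "I \<inter> J = {\<zero>\<^bsub>CB X\<^esub>}"
  show "ideal_coz X I \<inter> ideal_coz X J = {}"
  proof (rule ccontr)
    assume "ideal_coz X I \<inter> ideal_coz X J \<noteq> {}"
    then obtain y f g where y: "y \<in> topspace (stone_cech X)"
      and f: "f \<in> I" "stone_cech_ext X f y \<noteq> 0" and g: "g \<in> J" "stone_cech_ext X g y \<noteq> 0"
      by (auto simp: in_ideal_coz)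
    have c: "f \<in> carrier (CB X)" "g \<in> carrier (CB X)"
      using f g I J ideal_subset_CB by blast+
    have "f \<otimes>\<^bsub>CB X\<^esub> g \<in> I \<inter> J"
      using f g c I J by (simp add: ideal.I_l_closed ideal.I_r_closed)
    then have "f \<otimes>\<^bsub>CB X\<^esub> g = \<zero>\<^bsub>CB X\<^esub>"
      using IJ by blast
    then show False
      using stone_cech_ext_mult[OF c y] stone_cech_ext_zero[OF y] f g by (metis mult_eq_0_iff)
  qed
next
  assume disj: "ideal_coz X I \<inter> ideal_coz X J = {}"
  have "ideal (I \<inter> J) (CB X)"
    using I J by (rule ring.i_intersect[OF cring.axioms(1)[OF cring_CB]])
  moreover have "ideal_coz X (I \<inter> J) = {}"
    using disj unfolding in_ideal_coz disjoint_iff set_eq_iff Int_iff empty_iff by blast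
  ultimately show "I \<inter> J = {\<zero>\<^bsub>CB X\<^esub>}"
    using ideal_coz_eq_empty_iff ideal_subset_CB ideal_zero_CB by metis
qed

lemma ideal_ideal_part:
  fixes G :: "('a \<Rightarrow> 'k::{real_normed_field,euclidean_space}) set"
  assumes "ideal G (CB X)"
  shows "ideal (ideal_part X G U) (CB X)"
proof (rule ideal_CB_I)
  note sub = ideal_subset_CB[OF assms]
  show "ideal_part X G U \<subseteq> carrier (CB X)"
    using sub by (auto simp: in_ideal_part)
  show "\<zero>\<^bsub>CB X\<^esub> \<in> ideal_part X G U"
    using ideal_zero_CB[OF assms] by (auto simp: in_ideal_part stone_cech_ext_zero)
  fix f g assume f: "f \<in> ideal_part X G U"
  then have fG: "f \<in> G" "f \<in> carrier (CB X)"
    using sub by (auto simp: in_ideal_part)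
  show "f \<oplus>\<^bsub>CB X\<^esub> g \<in> ideal_part X G U" if g: "g \<in> ideal_part X G U"
  proof -
    have gG: "g \<in> G" "g \<in> carrier (CB X)"
      using sub g by (auto simp: in_ideal_part)
    have "stone_cech_ext X (f \<oplus>\<^bsub>CB X\<^esub> g) y = 0" if "y \<in> topspace (stone_cech X) - U" for y
      using that f g stone_cech_ext_add[OF fG(2) gG(2)] by (simp add: in_ideal_part)
    then show ?thesis
      using ideal_add_CB[OF assms fG(1) gG(1)] by (simp add: in_ideal_part)
  qed
  show "g \<otimes>\<^bsub>CB X\<^esub> f \<in> ideal_part X G U" if g: "g \<in> carrier (CB X)"
  proof -
    have "stone_cech_ext X (g \<otimes>\<^bsub>CB X\<^esub> f) y = 0" if "y \<in> topspace (stone_cech X) - U" for y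
      using that f stone_cech_ext_mult[OF g fG(2)] by (simp add: in_ideal_part)
    then show ?thesis
      using ideal.I_l_closed[OF assms fG(1) g] by (simp add: in_ideal_part)
  qed
qed

lemma closed_ideal_imp_ideal: "closed_ideal X G \<Longrightarrow> ideal G (CB X)"
  by (simp add: closed_ideal_def)

lemma closed_ideal_iff:
  fixes G :: "('a \<Rightarrow> 'k::{real_normed_field,euclidean_space}) set"
  shows "closed_ideal X G \<longleftrightarrow> ideal G (CB X) \<and>
    (\<forall>f\<in>carrier (CB X). (\<forall>e>0. \<exists>g\<in>G. \<forall>y\<in>topspace (stone_cech X).
        dist (stone_cech_ext X f y) (stone_cech_ext X g y) \<le> e) \<longrightarrow> f \<in> G)"
proof (cases "ideal G (CB X)")
  case True
  note sub = ideal_subset_CB[OF True]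
  have "closedin (CB_topology X) G \<longleftrightarrow> CB_topology X closure_of G \<subseteq> G"
    using sub closure_of_subset_eq[of G "CB_topology X"]
    by (simp only: topspace_mtopology_of CB_def partial_object.simps simp_thms)
  then have "closed_ideal X G \<longleftrightarrow> (\<forall>f. f \<in> CB_topology X closure_of G \<longrightarrow> f \<in> G)"
    using True by (simp only: closed_ideal_def subset_iff simp_thms)
  then show ?thesis
    unfolding in_closure_of_CB_iff[OF sub] using True by blast
qed (simp add: closed_ideal_def)

lemma closed_ideal_ideal_part:
  fixes G :: "('a \<Rightarrow> 'k::{real_normed_field,euclidean_space}) set"
  assumes "closed_ideal X G"
  shows "closed_ideal X (ideal_part X G U)"
  unfolding closed_ideal_iff
proof (intro conjI ballI impI)
  show "ideal (ideal_part X G U) (CB X)"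
    using assms closed_ideal_imp_ideal ideal_ideal_part by blast
  fix f assume f: "f \<in> carrier (CB X)" and
    lim: "\<forall>e>0. \<exists>g\<in>ideal_part X G U. \<forall>y\<in>topspace (stone_cech X).
        dist (stone_cech_ext X f y) (stone_cech_ext X g y) \<le> e"
  have "f \<in> G"
  proof -
    have "\<exists>g\<in>G. \<forall>y\<in>topspace (stone_cech X).
        dist (stone_cech_ext X f y) (stone_cech_ext X g y) \<le> e" if "e > 0" for e
      using lim that unfolding ideal_part_def by blast
    then show ?thesis
      using assms f unfolding closed_ideal_iff by blast
  qed
  moreover have "stone_cech_ext X f y = 0" if y: "y \<in> topspace (stone_cech X) - U" for y
  proof -
    have "norm (stone_cech_ext X f y) \<le> e" if "e > 0" for e
    proof -
      obtain g where "g \<in> ideal_part X G U" "dist (stone_cech_ext X f y) (stone_cech_ext X g y) \<le> e"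
        using lim \<open>e > 0\<close> y by blast
      then show ?thesis
        using y by (auto simp: in_ideal_part)
    qed
    then have "norm (stone_cech_ext X f y) \<le> 0"
      by (rule field_le_epsilon) simp
    then show ?thesis by simp
  qed
  ultimately show "f \<in> ideal_part X G U"
    by (simp add: in_ideal_part)
qed

text \<open>
  If \<open>g\<close> in \<open>G\<close> does not vanish at \<open>y\<close> in \<open>U\<close>, multiply it by a Urysohn function that is 1 at
  \<open>y\<close> and 0 off \<open>U\<close>. Thus every open subset of \<open>ideal_coz X G\<close> is the open set of a subideal.
\<close>

lemma ideal_coz_ideal_part:
  fixes G :: "('a \<Rightarrow> 'k::{real_normed_field,euclidean_space}) set"
  assumes G: "ideal G (CB X)" and U: "openin (stone_cech X) U"
  shows "ideal_coz X (ideal_part X G U) = ideal_coz X G \<inter> U"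
proof
  show "ideal_coz X (ideal_part X G U) \<subseteq> ideal_coz X G \<inter> U"
  proof
    fix y assume "y \<in> ideal_coz X (ideal_part X G U)"
    then obtain g where y: "y \<in> topspace (stone_cech X)" "stone_cech_ext X g y \<noteq> 0"
        and g: "g \<in> ideal_part X G U"
      unfolding in_ideal_coz by blast
    then have "g \<in> G" "y \<in> U"
      by (auto simp: in_ideal_part)
    then show "y \<in> ideal_coz X G \<inter> U"
      using y unfolding Int_iff in_ideal_coz by blast
  qed
  show "ideal_coz X G \<inter> U \<subseteq> ideal_coz X (ideal_part X G U)"
  proof
    fix y assume y: "y \<in> ideal_coz X G \<inter> U"
    then obtain g where g: "g \<in> G" "stone_cech_ext X g y \<noteq> 0" and yK: "y \<in> topspace (stone_cech X)"
      by (auto simp: in_ideal_coz)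
    have "completely_regular_space (stone_cech X)"
      using compact_Hausdorff_or_regular_imp_normal_space normal_imp_completely_regular_space
        compact_space_stone_cech Hausdorff_space_stone_cech by blast
    moreover have "closedin (stone_cech X) (topspace (stone_cech X) - U)"
      using U by (simp add: closedin_diff)
    ultimately obtain u :: "_ \<Rightarrow> real" where
        u: "continuous_map (stone_cech X) (top_of_set {0..1}) u" "u y = 0"
           "u ` (topspace (stone_cech X) - U) \<subseteq> {1}"
      using y yK unfolding completely_regular_space_def by (metis Diff_iff IntD2)
    define \<phi> where "\<phi> = (\<lambda>z. of_real (1 - u z) :: 'k)"
    have "continuous_map (stone_cech X) euclideanreal u"
      using u(1) by (simp add: continuous_map_in_subtopology)
    then have "continuous_map (stone_cech X) euclidean \<phi>"
      unfolding \<phi>_def continuous_map_atin by (auto intro!: tendsto_intros)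
    then obtain p where p: "p \<in> carrier (CB X)"
      "\<And>y. y \<in> topspace (stone_cech X) \<Longrightarrow> stone_cech_ext X p y = \<phi> y"
      by (rule CB_pullback) blast
    have gc: "g \<in> carrier (CB X)"
      using g G ideal_subset_CB by blast
    have ext: "stone_cech_ext X (p \<otimes>\<^bsub>CB X\<^esub> g) z = \<phi> z * stone_cech_ext X g z"
      if "z \<in> topspace (stone_cech X)" for z
      using that stone_cech_ext_mult[OF p(1) gc] p(2) by simp
    have "p \<otimes>\<^bsub>CB X\<^esub> g \<in> ideal_part X G U"
      unfolding in_ideal_part
    proof (intro conjI ballI)
      show "p \<otimes>\<^bsub>CB X\<^esub> g \<in> G"
        using G g p(1) by (simp add: ideal.I_l_closed)
      fix z assume z: "z \<in> topspace (stone_cech X) - U"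
      then have "u z = 1" using u(3) by blast
      then show "stone_cech_ext X (p \<otimes>\<^bsub>CB X\<^esub> g) z = 0"
        using ext z by (simp add: \<phi>_def)
    qed
    moreover have "stone_cech_ext X (p \<otimes>\<^bsub>CB X\<^esub> g) y \<noteq> 0"
      using ext[OF yK] g u(2) by (simp add: \<phi>_def)
    ultimately show "y \<in> ideal_coz X (ideal_part X G U)"
      using yK by (auto simp: in_ideal_coz)
  qed
qed

section \<open>Cutting a function along a clopen partition\<close>

text \<open>
  Let \<open>r\<close> be \<open>f\<close> on \<open>V\<close> and 0 elsewhere. It is continuous because \<open>f\<close> vanishes outside
  \<open>V \<union> W\<close>, but the indicator function of \<open>V\<close> need not be continuous, so \<open>r\<close> is not
  visibly a multiple of \<open>f\<close>. It is however a uniform limit of multiples: the cut-off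
  \<open>c = 1 - e / max e (norm r)\<close> is continuous and vanishes wherever \<open>r\<close> does, whence
  \<open>c f = c r\<close>, and \<open>c r\<close> differs from \<open>r\<close> by at most \<open>e\<close>. So \<open>r\<close> lies in the closed ideal \<open>G\<close>.
\<close>

lemma restrict_to_clopen_part:
  fixes G :: "('a \<Rightarrow> 'k::{real_normed_field,euclidean_space}) set"
  assumes G: "closed_ideal X G" and f: "f \<in> G"
    and V: "openin (stone_cech X) V" and W: "openin (stone_cech X) W" and VW: "V \<inter> W = {}"
    and cov: "Coz (stone_cech X) (stone_cech_ext X f) \<subseteq> V \<union> W"
  obtains h where "h \<in> ideal_part X G V"
    and "\<And>y. y \<in> V \<Longrightarrow> stone_cech_ext X h y = stone_cech_ext X f y"
proof -
  let ?K = "topspace (stone_cech X)" and ?f = "stone_cech_ext X f"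
  note I = closed_ideal_imp_ideal[OF G]
  have fc: "f \<in> carrier (CB X)"
    using f ideal_subset_CB[OF I] by blast
  note fcont = continuous_map_stone_cech_ext[OF fc]
  have VK: "V \<subseteq> ?K" and WK: "W \<subseteq> ?K"
    using V W openin_subset by auto
  define r where "r = (\<lambda>y. if y \<in> V then ?f y else 0)"
  have rcont: "continuous_map (stone_cech X) euclidean r"
    unfolding continuous_map
  proof (intro conjI allI impI)
    fix T :: "'k set" assume T: "openin euclidean T"
    have pre: "openin (stone_cech X) {y \<in> ?K. ?f y \<in> T}"
      using fcont T by (rule openin_continuous_map_preimage)
    show "openin (stone_cech X) {y \<in> ?K. r y \<in> T}"
    proof (cases "0 \<in> T")
      case True
      have "{y \<in> ?K. r y \<in> T} = {y \<in> ?K. ?f y \<in> T} \<union> W"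
        using True WK VW cov by (auto simp: r_def Coz_def)
      then show ?thesis
        using pre W by auto
    next
      case False
      have "{y \<in> ?K. r y \<in> T} = {y \<in> ?K. ?f y \<in> T} \<inter> V"
        using False by (auto simp: r_def)
      then show ?thesis
        using pre V by auto
    qed
  qed auto
  then obtain h where h: "h \<in> carrier (CB X)" "\<And>y. y \<in> ?K \<Longrightarrow> stone_cech_ext X h y = r y"
    by (rule CB_pullback) blast
  have "\<exists>g\<in>G. \<forall>y\<in>?K. dist (stone_cech_ext X h y) (stone_cech_ext X g y) \<le> e" if e: "e > 0" for e
  proof -
    define c where "c = (\<lambda>y. of_real (1 - e / max e (norm (r y))) :: 'k)"
    have "continuous_map (stone_cech X) euclidean c"
      using rcont e unfolding c_def continuous_map_atin
      by (auto intro!: tendsto_intros tendsto_max)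
    then obtain p where p: "p \<in> carrier (CB X)" "\<And>y. y \<in> ?K \<Longrightarrow> stone_cech_ext X p y = c y"
      by (rule CB_pullback) blast
    have "p \<otimes>\<^bsub>CB X\<^esub> f \<in> G"
      using I f p(1) by (simp add: ideal.I_l_closed)
    moreover have "dist (stone_cech_ext X h y) (stone_cech_ext X (p \<otimes>\<^bsub>CB X\<^esub> f) y) \<le> e"
      if y: "y \<in> ?K" for y
    proof -
      have "c y * ?f y = c y * r y"
        using e by (simp add: c_def r_def)
      then have "r y - c y * ?f y = of_real (e / max e (norm (r y))) * r y"
        by (simp add: c_def algebra_simps)
      then have "norm (r y - c y * ?f y) = norm (of_real (e / max e (norm (r y))) :: 'k) * norm (r y)"
        by (simp only: norm_mult)
      also have "\<dots> = e * (norm (r y) / max e (norm (r y)))"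
        using e unfolding norm_of_real by simp
      also have "\<dots> \<le> e * 1"
        using e by (intro mult_left_mono) (auto simp: divide_le_eq_1)
      finally show ?thesis
        using y h(2) p(2) stone_cech_ext_mult[OF p(1) fc y] by (simp add: dist_norm)
    qed
    ultimately show ?thesis by blast
  qed
  then have "h \<in> G"
    using G h(1) unfolding closed_ideal_iff by blast
  then have "h \<in> ideal_part X G V"
    using h(2) by (auto simp: in_ideal_part r_def)
  moreover have "stone_cech_ext X h y = ?f y" if "y \<in> V" for y
    using that h(2) VK by (auto simp: r_def)
  ultimately show thesis by (rule that)
qed

section \<open>Indecomposable closed ideals\<close>

text \<open>
  A separation of the open set splits each member of \<open>G\<close> into its restrictions to the two pieces,
  which again lie in \<open>G\<close> because \<open>G\<close> is closed; and the open sets of two direct summands form a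
  separation.
\<close>

lemma indecomposable_ideal_iff_connectedin:
  fixes G :: "('a \<Rightarrow> 'k::{real_normed_field,euclidean_space}) set"
  assumes G: "closed_ideal X G"
  shows "indecomposable_ideal G (CB X) \<longleftrightarrow> connectedin (stone_cech X) (ideal_coz X G)"
proof
  note I = closed_ideal_imp_ideal[OF G]
  note sub = ideal_subset_CB[OF I]
  note opn = openin_ideal_coz[OF sub]
  assume indec: "indecomposable_ideal G (CB X)"
  show "connectedin (stone_cech X) (ideal_coz X G)"
  proof (rule ccontr)
    assume "\<not> connectedin (stone_cech X) (ideal_coz X G)"
    then obtain E F where E: "openin (stone_cech X) E" and F: "openin (stone_cech X) F"
      and cov: "ideal_coz X G \<subseteq> E \<union> F" and disj: "E \<inter> F \<inter> ideal_coz X G = {}"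
      and ne: "E \<inter> ideal_coz X G \<noteq> {}" "F \<inter> ideal_coz X G \<noteq> {}"
      unfolding connectedin using ideal_coz_subset_topspace[of X G] by auto
    define V where "V = ideal_coz X G \<inter> E"
    define W where "W = ideal_coz X G \<inter> F"
    have V: "openin (stone_cech X) V" and W: "openin (stone_cech X) W"
      using E F opn unfolding V_def W_def by auto
    have VW: "V \<inter> W = {}" and un: "ideal_coz X G = V \<union> W"
      using disj cov unfolding V_def W_def by auto
    note IV = ideal_ideal_part[OF I, of V] and IW = ideal_ideal_part[OF I, of W]
    have cV: "ideal_coz X (ideal_part X G V) = V" and cW: "ideal_coz X (ideal_part X G W) = W"
      using ideal_coz_ideal_part[OF I V] ideal_coz_ideal_part[OF I W] un by auto
    have "V \<noteq> {}" "W \<noteq> {}"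
      using ne unfolding V_def W_def by auto
    then have nz: "ideal_part X G V \<noteq> {\<zero>\<^bsub>CB X\<^esub>}" "ideal_part X G W \<noteq> {\<zero>\<^bsub>CB X\<^esub>}"
      using cV cW ideal_coz_eq_empty_iff ideal_subset_CB ideal_zero_CB IV IW by metis+
    have int: "ideal_part X G V \<inter> ideal_part X G W = {\<zero>\<^bsub>CB X\<^esub>}"
      using disjoint_ideals_iff[OF IV IW] cV cW VW by simp
    have "G = ideal_part X G V <+>\<^bsub>CB X\<^esub> ideal_part X G W"
    proof
      show "G \<subseteq> ideal_part X G V <+>\<^bsub>CB X\<^esub> ideal_part X G W"
      proof
        fix f assume f: "f \<in> G"
        have cf: "Coz (stone_cech X) (stone_cech_ext X f) \<subseteq> V \<union> W"
          using f un[symmetric] by (auto simp: ideal_coz_def)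
        obtain g where g: "g \<in> ideal_part X G V"
          "\<And>y. y \<in> V \<Longrightarrow> stone_cech_ext X g y = stone_cech_ext X f y"
          using restrict_to_clopen_part[OF G f V W VW cf] by blast
        obtain h where h: "h \<in> ideal_part X G W"
          "\<And>y. y \<in> W \<Longrightarrow> stone_cech_ext X h y = stone_cech_ext X f y"
          using restrict_to_clopen_part[OF G f W V] VW cf by (metis Int_commute Un_commute)
        have gc: "g \<in> carrier (CB X)" and hc: "h \<in> carrier (CB X)" and fc: "f \<in> carrier (CB X)"
          using g(1) h(1) f sub by (auto simp: in_ideal_part)
        have "f = g \<oplus>\<^bsub>CB X\<^esub> h"
        proof (rule CB_eqI[OF fc cring.cring_simprules(1)[OF cring_CB gc hc]])
          fix y assume y: "y \<in> topspace (stone_cech X)"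
          have "y \<in> V - W \<or> y \<in> W - V \<or> y \<notin> V \<union> W"
            using VW by blast
          moreover have "y \<notin> V \<Longrightarrow> stone_cech_ext X g y = 0" "y \<notin> W \<Longrightarrow> stone_cech_ext X h y = 0"
            using g(1) h(1) y by (auto simp: in_ideal_part)
          moreover have "y \<notin> V \<union> W \<Longrightarrow> stone_cech_ext X f y = 0"
            using cf y by (auto simp: Coz_def)
          ultimately show "stone_cech_ext X f y = stone_cech_ext X (g \<oplus>\<^bsub>CB X\<^esub> h) y"
            unfolding stone_cech_ext_add[OF gc hc y] using g(2)[of y] h(2)[of y] by auto
        qed
        then show "f \<in> ideal_part X G V <+>\<^bsub>CB X\<^esub> ideal_part X G W"
          using g(1) h(1) unfolding set_add_defs(1) set_mult_def by auto
      qed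
      show "ideal_part X G V <+>\<^bsub>CB X\<^esub> ideal_part X G W \<subseteq> G"
        using ideal_add_CB[OF I] unfolding set_add_defs(1) set_mult_def
        by (auto simp: in_ideal_part)
    qed
    then show False
      using indec nz int IV IW unfolding indecomposable_ideal_def by blast
  qed
next
  note I = closed_ideal_imp_ideal[OF G]
  assume conn: "connectedin (stone_cech X) (ideal_coz X G)"
  show "indecomposable_ideal G (CB X)"
    unfolding indecomposable_ideal_def
  proof (intro conjI notI I, elim exE conjE)
    fix A B assume A: "ideal A (CB X)" and B: "ideal B (CB X)"
      and nz: "A \<noteq> {\<zero>\<^bsub>CB X\<^esub>}" "B \<noteq> {\<zero>\<^bsub>CB X\<^esub>}" and AB: "A \<inter> B = {\<zero>\<^bsub>CB X\<^esub>}"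
      and sum: "G = A <+>\<^bsub>CB X\<^esub> B"
    interpret cring "CB X :: ('a \<Rightarrow> 'k) ring" by (rule cring_CB)
    note Ac = ideal_subset_CB[OF A] and Bc = ideal_subset_CB[OF B]
    have in_G: "a \<oplus>\<^bsub>CB X\<^esub> b \<in> G" if "a \<in> A" "b \<in> B" for a b
      using that sum unfolding set_add_defs(1) set_mult_def by auto
    have AG: "A \<subseteq> G"
    proof
      fix a assume "a \<in> A"
      then show "a \<in> G"
        using in_G[of a "\<zero>\<^bsub>CB X\<^esub>"] ideal_zero_CB[OF B] Ac by auto
    qed
    have BG: "B \<subseteq> G"
    proof
      fix b assume "b \<in> B"
      then show "b \<in> G"
        using in_G[of "\<zero>\<^bsub>CB X\<^esub>" b] ideal_zero_CB[OF A] Bc by auto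
    qed
    have cov: "ideal_coz X G \<subseteq> ideal_coz X A \<union> ideal_coz X B"
    proof
      fix y assume "y \<in> ideal_coz X G"
      then obtain a b where y: "y \<in> topspace (stone_cech X)" and a: "a \<in> A" and b: "b \<in> B"
        and "stone_cech_ext X (a \<oplus>\<^bsub>CB X\<^esub> b) y \<noteq> 0"
        unfolding in_ideal_coz sum set_add_defs(1) set_mult_def by auto
      moreover have "a \<in> carrier (CB X)" "b \<in> carrier (CB X)"
        using a b Ac Bc by auto
      ultimately have "stone_cech_ext X a y \<noteq> 0 \<or> stone_cech_ext X b y \<noteq> 0"
        by (auto simp: stone_cech_ext_add)
      then show "y \<in> ideal_coz X A \<union> ideal_coz X B"
        using y a b unfolding Un_iff in_ideal_coz by blast
    qed
    have "ideal_coz X A \<noteq> {}" "ideal_coz X B \<noteq> {}"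
      using nz ideal_coz_eq_empty_iff Ac Bc ideal_zero_CB A B by metis+
    moreover have "ideal_coz X A \<subseteq> ideal_coz X G" "ideal_coz X B \<subseteq> ideal_coz X G"
      using AG BG unfolding ideal_coz_def by blast+
    moreover have "ideal_coz X A \<inter> ideal_coz X B = {}"
      using AB disjoint_ideals_iff[OF A B] by simp
    ultimately show False
      using connectedinD[OF conn openin_ideal_coz[OF Ac] openin_ideal_coz[OF Bc] cov] by blast
  qed
qed

section \<open>Direct sums of ideals\<close>

lemma stone_cech_ext_finsum:
  fixes f :: "'i \<Rightarrow> 'a \<Rightarrow> 'k::{real_normed_field,euclidean_space}"
  assumes "finite F" and "\<And>i. i \<in> F \<Longrightarrow> f i \<in> carrier (CB X)" and y: "y \<in> topspace (stone_cech X)"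
  shows "stone_cech_ext X (finsum (CB X) f F) y = (\<Sum>i\<in>F. stone_cech_ext X (f i) y)"
  using assms(1,2)
proof (induction F)
  interpret cring "CB X :: ('a \<Rightarrow> 'k) ring" by (rule cring_CB)
  case empty
  then show ?case
    using stone_cech_ext_zero[OF y] by simp
next
  interpret cring "CB X :: ('a \<Rightarrow> 'k) ring" by (rule cring_CB)
  case (insert i F)
  have "finsum (CB X) f (insert i F) = f i \<oplus>\<^bsub>CB X\<^esub> finsum (CB X) f F"
    using insert by (intro finsum_insert) auto
  then show ?case
    using insert y by (simp add: stone_cech_ext_add finsum_closed Pi_iff)
qed

lemma (in ring) ideal_sum_subset:
  assumes J: "ideal J R" and sub: "\<And>i. i \<in> I \<Longrightarrow> G i \<subseteq> J"
  shows "ideal_sum R I G \<subseteq> J"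
proof -
  interpret J: ideal J R by (rule J)
  have "finsum R x F \<in> J" if "finite F" "\<And>i. i \<in> F \<Longrightarrow> x i \<in> J" for x F
    using that
  proof (induction F)
    case (insert i F)
    have "finsum R x (insert i F) = x i \<oplus> finsum R x F"
      using insert J.a_subset by (intro finsum_insert) auto
    then show ?case
      using insert by simp
  qed simp
  moreover have "x i \<in> J" if "F \<subseteq> I" "x \<in> (\<Pi> i\<in>F. G i)" "i \<in> F" for x F i
    using that sub by blast
  ultimately show ?thesis
    unfolding ideal_sum_def by blast
qed

lemma (in ring) subset_ideal_sum:
  fixes G :: "'i \<Rightarrow> 'a set"
  assumes "i \<in> I" and "G i \<subseteq> carrier R"
  shows "G i \<subseteq> ideal_sum R I G"
proof
  fix g assume g: "g \<in> G i"
  have "finsum R (\<lambda>_::'i. g) (insert i {}) = g \<oplus> finsum R (\<lambda>_::'i. g) {}"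
    using g assms by (intro finsum_insert) auto
  then have "g = finsum R (\<lambda>_. g) {i}"
    using g assms by auto
  moreover have "finite {i}" "{i} \<subseteq> I" "(\<lambda>_. g) \<in> (\<Pi> j\<in>{i}. G j)"
    using g assms by auto
  ultimately show "g \<in> ideal_sum R I G"
    unfolding ideal_sum_def by blast
qed

lemma ideal_coz_ideal_sum:
  fixes G :: "'i \<Rightarrow> ('a \<Rightarrow> 'k::{real_normed_field,euclidean_space}) set"
  assumes sub: "\<And>i. i \<in> I \<Longrightarrow> G i \<subseteq> carrier (CB X)"
  shows "ideal_coz X (ideal_sum (CB X) I G) = (\<Union>i\<in>I. ideal_coz X (G i))"
proof
  show "ideal_coz X (ideal_sum (CB X) I G) \<subseteq> (\<Union>i\<in>I. ideal_coz X (G i))"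
  proof
    fix y assume "y \<in> ideal_coz X (ideal_sum (CB X) I G)"
    then obtain F x where y: "y \<in> topspace (stone_cech X)" and F: "finite F" "F \<subseteq> I"
      and x: "x \<in> (\<Pi> i\<in>F. G i)" and nz: "stone_cech_ext X (finsum (CB X) x F) y \<noteq> 0"
      unfolding in_ideal_coz ideal_sum_def by blast
    have "x i \<in> carrier (CB X)" if "i \<in> F" for i
      using that x F sub by blast
    then have "(\<Sum>i\<in>F. stone_cech_ext X (x i) y) \<noteq> 0"
      using nz stone_cech_ext_finsum[OF F(1) _ y, of x] by simp
    then obtain i where "i \<in> F" "stone_cech_ext X (x i) y \<noteq> 0"
      by (meson sum.neutral)
    then show "y \<in> (\<Union>i\<in>I. ideal_coz X (G i))"
      using y F x unfolding UN_iff in_ideal_coz by blast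
  qed
  interpret cring "CB X :: ('a \<Rightarrow> 'k) ring" by (rule cring_CB)
  show "(\<Union>i\<in>I. ideal_coz X (G i)) \<subseteq> ideal_coz X (ideal_sum (CB X) I G)"
    using subset_ideal_sum[of _ I G] sub unfolding ideal_coz_def by blast
qed

text \<open>
  Directness, a condition on each summand against the sum of all the others, reduces to a pairwise
  one: the open set of a sum is a union, and a set disjoint from each of several sets is disjoint
  from their union.
\<close>

lemma is_internal_direct_sum_CB_iff:
  fixes G :: "'i \<Rightarrow> ('a \<Rightarrow> 'k::{real_normed_field,euclidean_space}) set"
  assumes G: "\<And>i. i \<in> I \<Longrightarrow> ideal (G i) (CB X)"
  shows "is_internal_direct_sum (CB X) I G S \<longleftrightarrow>
    S = ideal_sum (CB X) I G \<and> disjoint_family_on (\<lambda>i. ideal_coz X (G i)) I"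
proof -
  interpret cring "CB X :: ('a \<Rightarrow> 'k) ring" by (rule cring_CB)
  have sub: "G i \<subseteq> carrier (CB X)" if "i \<in> I" for i
    using that G ideal_subset_CB by blast
  have "(\<forall>i\<in>I. G i \<inter> ideal_sum (CB X) (I - {i}) G = {\<zero>\<^bsub>CB X\<^esub>}) \<longleftrightarrow>
      disjoint_family_on (\<lambda>i. ideal_coz X (G i)) I" (is "?L \<longleftrightarrow> ?R")
  proof
    assume L: ?L
    show ?R
      unfolding disjoint_family_on_def
    proof (intro ballI impI)
      fix i j assume ij: "i \<in> I" "j \<in> I" "i \<noteq> j"
      have "G j \<subseteq> ideal_sum (CB X) (I - {i}) G"
        using ij sub by (intro subset_ideal_sum) auto
      then have "G i \<inter> G j \<subseteq> {\<zero>\<^bsub>CB X\<^esub>}"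
        using L ij by blast
      then have "G i \<inter> G j = {\<zero>\<^bsub>CB X\<^esub>}"
        using ideal_zero_CB[OF G[OF ij(1)]] ideal_zero_CB[OF G[OF ij(2)]] by blast
      then show "ideal_coz X (G i) \<inter> ideal_coz X (G j) = {}"
        using disjoint_ideals_iff G ij by blast
    qed
  next
    assume R: ?R
    show ?L
    proof
      fix i assume i: "i \<in> I"
      let ?S = "ideal_sum (CB X) (I - {i}) G"
      have "\<zero>\<^bsub>CB X\<^esub> \<in> ?S"
        unfolding ideal_sum_def by (auto intro!: exI[of _ "{}"])
      then have zero: "\<zero>\<^bsub>CB X\<^esub> \<in> G i \<inter> ?S"
        using ideal_zero_CB[OF G[OF i]] by blast
      have "ideal_coz X (G i \<inter> ?S) \<subseteq> ideal_coz X (G i) \<inter> ideal_coz X ?S"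
        unfolding ideal_coz_def by blast
      also have "ideal_coz X ?S = (\<Union>j\<in>I - {i}. ideal_coz X (G j))"
        using sub by (intro ideal_coz_ideal_sum) auto
      also have "ideal_coz X (G i) \<inter> \<dots> = {}"
        using R i unfolding disjoint_family_on_def by blast
      finally show "G i \<inter> ?S = {\<zero>\<^bsub>CB X\<^esub>}"
        using ideal_coz_eq_empty_iff[OF _ zero] sub[OF i] by blast
    qed
  qed
  then show ?thesis
    by (simp add: is_internal_direct_sum_def)
qed

text \<open>
  A uniform limit that is non-zero at a point is approximated by functions non-zero there.
\<close>

lemma ideal_coz_closure_of:
  fixes S :: "('a \<Rightarrow> 'k::{real_normed_field,euclidean_space}) set"
  assumes S: "S \<subseteq> carrier (CB X)"
  shows "ideal_coz X (CB_topology X closure_of S) = ideal_coz X S"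
proof
  show "ideal_coz X (CB_topology X closure_of S) \<subseteq> ideal_coz X S"
  proof
    fix y assume "y \<in> ideal_coz X (CB_topology X closure_of S)"
    then obtain f where y: "y \<in> topspace (stone_cech X)" and nz: "stone_cech_ext X f y \<noteq> 0"
      and f: "f \<in> CB_topology X closure_of S"
      unfolding in_ideal_coz by blast
    have "norm (stone_cech_ext X f y) / 2 > 0"
      using nz by simp
    then obtain g where g: "g \<in> S"
      "dist (stone_cech_ext X f y) (stone_cech_ext X g y) \<le> norm (stone_cech_ext X f y) / 2"
      using f y unfolding in_closure_of_CB_iff[OF S] by blast
    then have "stone_cech_ext X g y \<noteq> 0"
      using nz by auto
    then show "y \<in> ideal_coz X S"
      using y g(1) unfolding in_ideal_coz by blast
  qed
  have "S \<subseteq> CB_topology X closure_of S"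
    using S by (intro closure_of_subset) (simp add: CB_def)
  then show "ideal_coz X S \<subseteq> ideal_coz X (CB_topology X closure_of S)"
    unfolding ideal_coz_def by blast
qed

text \<open>
  Given \<open>f\<close> in \<open>G\<close> and \<open>e > 0\<close>, the set where \<open>norm f \<ge> e\<close> is compact, hence covered by finitely
  many \<open>V i\<close>. The restrictions of \<open>f\<close> to these \<open>V i\<close> add up to a function that agrees with \<open>f\<close> on
  them and is 0 elsewhere, where \<open>f\<close> is smaller than \<open>e\<close>.
\<close>

lemma closure_of_sum_of_parts:
  fixes G :: "('a \<Rightarrow> 'k::{real_normed_field,euclidean_space}) set"
  assumes G: "closed_ideal X G" and V: "\<And>i. i \<in> I \<Longrightarrow> openin (stone_cech X) (V i)"
    and disj: "disjoint_family_on V I" and cov: "(\<Union>i\<in>I. V i) = ideal_coz X G"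
  shows "CB_topology X closure_of ideal_sum (CB X) I (\<lambda>i. ideal_part X G (V i)) = G"
proof
  let ?K = "topspace (stone_cech X)" and ?S = "ideal_sum (CB X) I (\<lambda>i. ideal_part X G (V i))"
  note J = closed_ideal_imp_ideal[OF G]
  note sub = ideal_subset_CB[OF J]
  interpret cring "CB X :: ('a \<Rightarrow> 'k) ring" by (rule cring_CB)
  have SG: "?S \<subseteq> G"
    using J by (rule ideal_sum_subset) (auto simp: in_ideal_part)
  then show "CB_topology X closure_of ?S \<subseteq> G"
    using G by (intro closure_of_minimal) (auto simp: closed_ideal_def)
  have Sc: "?S \<subseteq> carrier (CB X)"
    using SG sub by (rule subset_trans)
  show "G \<subseteq> CB_topology X closure_of ?S"
  proof
    fix f assume f: "f \<in> G"
    have fc: "f \<in> carrier (CB X)"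
      using f sub by blast
    have "\<exists>g\<in>?S. \<forall>y\<in>?K. dist (stone_cech_ext X f y) (stone_cech_ext X g y) \<le> e" if e: "e > 0" for e
    proof -
      define C where "C = {y \<in> ?K. stone_cech_ext X f y \<in> - ball 0 e}"
      have "closedin (stone_cech X) C"
        unfolding C_def using continuous_map_stone_cech_ext[OF fc]
        by (rule closedin_continuous_map_preimage) auto
      then have "compactin (stone_cech X) C"
        using compact_space_stone_cech closedin_compact_space by blast
      moreover have "C \<subseteq> \<Union> (V ` I)"
      proof
        fix y assume "y \<in> C"
        then have "y \<in> ?K" "stone_cech_ext X f y \<noteq> 0"
          using e by (auto simp: C_def)
        then show "y \<in> \<Union> (V ` I)"
          using f unfolding cov in_ideal_coz by blast
      qed
      ultimately obtain \<F> where "finite \<F>" "\<F> \<subseteq> V ` I" "C \<subseteq> \<Union>\<F>"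
        using compactinD[of "stone_cech X" C "V ` I"] V by blast
      then obtain F where F: "F \<subseteq> I" "finite F" "C \<subseteq> (\<Union>i\<in>F. V i)"
        using finite_subset_image by metis
      have "\<exists>h. h \<in> ideal_part X G (V i) \<and> (\<forall>y\<in>V i. stone_cech_ext X h y = stone_cech_ext X f y)"
        if i: "i \<in> I" for i
      proof -
        let ?W = "\<Union>j\<in>I - {i}. V j"
        have W: "openin (stone_cech X) ?W"
          using V by blast
        have VW: "V i \<inter> ?W = {}"
          using disj i unfolding disjoint_family_on_def by blast
        have "Coz (stone_cech X) (stone_cech_ext X f) \<subseteq> ideal_coz X G"
          using f unfolding ideal_coz_def by blast
        also have "\<dots> \<subseteq> V i \<union> ?W"
          unfolding cov[symmetric] by blast
        finally have cf: "Coz (stone_cech X) (stone_cech_ext X f) \<subseteq> V i \<union> ?W" .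
        obtain h where "h \<in> ideal_part X G (V i)"
          "\<And>y. y \<in> V i \<Longrightarrow> stone_cech_ext X h y = stone_cech_ext X f y"
          using restrict_to_clopen_part[OF G f V[OF i] W VW cf] by blast
        then show ?thesis by blast
      qed
      then obtain h where h: "\<And>i. i \<in> I \<Longrightarrow> h i \<in> ideal_part X G (V i)"
        and hf: "\<And>i y. i \<in> I \<Longrightarrow> y \<in> V i \<Longrightarrow> stone_cech_ext X (h i) y = stone_cech_ext X f y"
        by metis
      have hc: "h i \<in> carrier (CB X)" if "i \<in> F" for i
        using h[of i] that F(1) sub by (auto simp: in_ideal_part)
      have "finsum (CB X) h F \<in> ?S"
        unfolding ideal_sum_def using F h by blast
      moreover have "dist (stone_cech_ext X f y) (stone_cech_ext X (finsum (CB X) h F) y) \<le> e"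
        if y: "y \<in> ?K" for y
      proof (cases "\<exists>i\<in>F. y \<in> V i")
        case True
        then obtain i where i: "i \<in> F" "y \<in> V i" by blast
        have "stone_cech_ext X (h j) y = (if j = i then stone_cech_ext X f y else 0)" if j: "j \<in> F" for j
        proof (cases "j = i")
          case True
          then show ?thesis using hf i F(1) by auto
        next
          case False
          then have "y \<notin> V j"
            using disj i j F(1) unfolding disjoint_family_on_def by blast
          then show ?thesis
            using False h[of j] j F(1) y by (auto simp: in_ideal_part)
        qed
        then have "(\<Sum>j\<in>F. stone_cech_ext X (h j) y) = stone_cech_ext X f y"
          using i F(2) by simp
        then show ?thesis
          using stone_cech_ext_finsum[OF F(2) hc y] e by simp
      next
        case False
        then have "stone_cech_ext X (h j) y = 0" if "j \<in> F" for j
          using that h[of j] F(1) y by (auto simp: in_ideal_part)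
        then have "(\<Sum>j\<in>F. stone_cech_ext X (h j) y) = 0"
          by (intro sum.neutral) blast
        moreover have "norm (stone_cech_ext X f y) \<le> e"
          using False F(3) y by (force simp: C_def)
        ultimately show ?thesis
          using stone_cech_ext_finsum[OF F(2) hc y] by simp
      qed
      ultimately show ?thesis by blast
    qed
    then show "f \<in> CB_topology X closure_of ?S"
      unfolding in_closure_of_CB_iff[OF Sc] using fc by blast
  qed
qed

section \<open>Local connectedness of the spectrum\<close>

lemma spectrum_eq: "spectrum X H = subtopology (stone_cech X) (ideal_coz X H)"
  by (simp add: spectrum_def ideal_coz_def)

text \<open>
  The summands are indexed by themselves: the component that belongs to a summand \<open>i\<close> is recovered
  as \<open>ideal_coz X i\<close>, so no choice of a component for each index is needed.
\<close>

lemma decomposition_if_locally_connected: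
  fixes H :: "('a \<Rightarrow> 'k::{real_normed_field,euclidean_space}) set"
  assumes H: "closed_ideal X H" and lc: "locally_connected_space (spectrum X H)"
    and G: "closed_ideal X G" and GH: "G \<subseteq> H"
  shows "\<exists>(I :: ('a \<Rightarrow> 'k) set set) G' S.
    (\<forall>i\<in>I. closed_ideal X (G' i) \<and> indecomposable_ideal (G' i) (CB X)) \<and>
    is_internal_direct_sum (CB X) I G' S \<and> G = CB_topology X closure_of S"
proof -
  note J = closed_ideal_imp_ideal[OF G]
  note opG = openin_ideal_coz[OF ideal_subset_CB[OF J]]
  note opH = openin_ideal_coz[OF ideal_subset_CB[OF closed_ideal_imp_ideal[OF H]]]
  have cGH: "ideal_coz X G \<subseteq> ideal_coz X H"
    using GH unfolding ideal_coz_def by blast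
  define \<C> where "\<C> = connected_components_of (subtopology (stone_cech X) (ideal_coz X G))"
  have un: "\<Union>\<C> = ideal_coz X G"
    unfolding \<C>_def Union_connected_components_of
    by (simp add: inf.absorb2 ideal_coz_subset_topspace)
  have conn: "connectedin (stone_cech X) C" if "C \<in> \<C>" for C
    using connectedin_connected_components_of[OF that[unfolded \<C>_def]]
    by (simp add: connectedin_subtopology)
  have opn: "openin (stone_cech X) C" if C: "C \<in> \<C>" for C
  proof -
    have "openin (spectrum X H) (ideal_coz X G)"
      using opG opH cGH unfolding spectrum_eq by (simp add: openin_open_subtopology)
    moreover have "C \<in> connected_components_of (subtopology (spectrum X H) (ideal_coz X G))"
      using C cGH unfolding \<C>_def spectrum_eq subtopology_subtopology by (simp add: inf.absorb2)
    ultimately have "openin (spectrum X H) C"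
      using lc[unfolded locally_connected_space_open_connected_components, rule_format, OF conjI]
      by simp
    then show ?thesis
      using opH unfolding spectrum_eq by (simp add: openin_open_subtopology)
  qed
  define I where "I = ideal_part X G ` \<C>"
  have coz: "ideal_coz X (ideal_part X G C) = C" if "C \<in> \<C>" for C
    using ideal_coz_ideal_part[OF J opn[OF that]] un that by blast
  have cozI: "ideal_coz X i \<in> \<C>" if "i \<in> I" for i
    using that coz by (auto simp: I_def)
  have inj: "inj_on (ideal_coz X) I"
    unfolding I_def by (rule inj_onI) (elim imageE, simp add: coz)
  have disj: "disjoint_family_on (ideal_coz X) I"
    unfolding disjoint_family_on_def
  proof (intro ballI impI)
    fix i j assume ij: "i \<in> I" "j \<in> I" "i \<noteq> j"
    then have "ideal_coz X i \<noteq> ideal_coz X j"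
      using inj_on_eq_iff[OF inj] by simp
    then show "ideal_coz X i \<inter> ideal_coz X j = {}"
      using connected_components_of_overlap cozI[OF ij(1)] cozI[OF ij(2)] unfolding \<C>_def by blast
  qed
  have cov: "(\<Union>i\<in>I. ideal_coz X i) = ideal_coz X G"
    using coz un by (simp add: I_def)
  let ?P = "\<lambda>i :: ('a \<Rightarrow> 'k) set. ideal_part X G (ideal_coz X i)"
  have cozP: "ideal_coz X (?P i) = ideal_coz X i" if "i \<in> I" for i
    using coz cozI that by blast
  have P: "closed_ideal X (?P i)" for i
    using G by (rule closed_ideal_ideal_part)
  have "indecomposable_ideal (?P i) (CB X)" if "i \<in> I" for i
    unfolding indecomposable_ideal_iff_connectedin[OF P] cozP[OF that]
    using conn cozI that by blast
  moreover have "is_internal_direct_sum (CB X) I ?P (ideal_sum (CB X) I ?P)"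
  proof -
    have "disjoint_family_on (\<lambda>i. ideal_coz X (?P i)) I"
      using disj cozP unfolding disjoint_family_on_def by simp
    then show ?thesis
      using is_internal_direct_sum_CB_iff[of I ?P X, OF closed_ideal_imp_ideal[OF P]] by blast
  qed
  moreover have "CB_topology X closure_of ideal_sum (CB X) I ?P = G"
    using closure_of_sum_of_parts[of X G I "ideal_coz X", OF G opn[OF cozI] disj cov] .
  ultimately show ?thesis
    using P by (intro exI[of _ I] exI[of _ ?P] exI[of _ "ideal_sum (CB X) I ?P"]) simp
qed

text \<open>
  Decompose the part of \<open>H\<close> supported in a given open set \<open>U\<close>: the open sets of the summands are
  connected and cover \<open>U\<close>, so the one that contains a given point is the connected open
  neighbourhood sought.
\<close>

lemma locally_connected_if_decompositions:
  fixes H :: "('a \<Rightarrow> 'k::{real_normed_field,euclidean_space}) set"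
  assumes H: "closed_ideal X H"
    and dec: "\<And>G. closed_ideal X G \<Longrightarrow> G \<subseteq> H \<Longrightarrow>
      \<exists>(I :: 'i set) G' S.
        (\<forall>i\<in>I. closed_ideal X (G' i) \<and> indecomposable_ideal (G' i) (CB X)) \<and>
        is_internal_direct_sum (CB X) I G' S \<and> G = CB_topology X closure_of S"
  shows "locally_connected_space (spectrum X H)"
  unfolding locally_connected_space
proof (intro allI impI, elim conjE)
  note J = closed_ideal_imp_ideal[OF H]
  note opH = openin_ideal_coz[OF ideal_subset_CB[OF J]]
  interpret cring "CB X :: ('a \<Rightarrow> 'k) ring" by (rule cring_CB)
  fix U x assume U: "openin (spectrum X H) U" and x: "x \<in> U"
  have opU: "openin (stone_cech X) U" and UH: "U \<subseteq> ideal_coz X H"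
    using U opH unfolding spectrum_eq by (auto simp: openin_open_subtopology)
  define G where "G = ideal_part X H U"
  have G: "closed_ideal X G" "G \<subseteq> H"
    unfolding G_def using H by (auto simp: closed_ideal_ideal_part in_ideal_part)
  have cG: "ideal_coz X G = U"
    unfolding G_def using ideal_coz_ideal_part[OF J opU] UH by blast
  obtain I :: "'i set" and G' S where
      G': "\<And>i. i \<in> I \<Longrightarrow> closed_ideal X (G' i)" "\<And>i. i \<in> I \<Longrightarrow> indecomposable_ideal (G' i) (CB X)"
      and S: "is_internal_direct_sum (CB X) I G' S" and GS: "G = CB_topology X closure_of S"
    using dec[OF G] by blast
  have sub: "G' i \<subseteq> carrier (CB X)" if "i \<in> I" for i
    using G'(1)[OF that] closed_ideal_imp_ideal ideal_subset_CB by blast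
  have S_eq: "S = ideal_sum (CB X) I G'"
    using S by (simp add: is_internal_direct_sum_def)
  have "S \<subseteq> carrier (CB X)"
    unfolding S_eq using sub by (intro ideal_sum_subset oneideal)
  then have "U = (\<Union>i\<in>I. ideal_coz X (G' i))"
    using ideal_coz_closure_of[of S X] ideal_coz_ideal_sum[of I G' X, OF sub]
    unfolding cG[symmetric] GS S_eq by simp
  then obtain i where i: "i \<in> I" "x \<in> ideal_coz X (G' i)" "ideal_coz X (G' i) \<subseteq> U"
    using x by blast
  have "openin (spectrum X H) (ideal_coz X (G' i))"
    using opH openin_ideal_coz[OF sub[OF i(1)]] i(3) UH
    unfolding spectrum_eq by (auto simp: openin_open_subtopology)
  moreover have "connectedin (spectrum X H) (ideal_coz X (G' i))"
    using indecomposable_ideal_iff_connectedin[OF G'(1)] G'(2) i UH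
    unfolding spectrum_eq connectedin_subtopology by blast
  ultimately show "\<exists>V. openin (spectrum X H) V \<and> connectedin (spectrum X H) V \<and> x \<in> V \<and> V \<subseteq> U"
    using i by blast
qed

theorem locally_connected_spectrum_iff:
  fixes H :: "('a \<Rightarrow> 'k::{real_normed_field,euclidean_space}) set"
  assumes H: "closed_ideal X H"
  shows "locally_connected_space (spectrum X H) \<longleftrightarrow>
    (\<forall>G. closed_ideal X G \<and> G \<subseteq> H \<longrightarrow>
      (\<exists>(I :: ('a \<Rightarrow> 'k) set set) G' S.
        (\<forall>i\<in>I. closed_ideal X (G' i) \<and> indecomposable_ideal (G' i) (CB X)) \<and>
        is_internal_direct_sum (CB X) I G' S \<and> G = CB_topology X closure_of S))"
    (is "?L \<longleftrightarrow> ?R")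
proof
  assume ?L
  then show ?R
    using decomposition_if_locally_connected[OF H] by simp
next
  assume ?R
  then show ?L
    by (intro locally_connected_if_decompositions[OF H, where 'i = "('a \<Rightarrow> 'k) set"]) simp
qed

theorem theorem3p10:
  fixes X :: "'a topology"
  assumes "completely_regular_space X" and "Hausdorff_space X"
  shows
    "(\<forall>H :: ('a \<Rightarrow> real) set. closed_ideal X H \<and> nonvanishing X H \<longrightarrow>
        (locally_connected_space (spectrum X H) \<longleftrightarrow>
         (\<forall>G. closed_ideal X G \<and> G \<subseteq> H \<longrightarrow>
           (\<exists>(I :: ('a \<Rightarrow> real) set set) G' S.
              (\<forall>i\<in>I. closed_ideal X (G' i) \<and> indecomposable_ideal (G' i) (CB X)) \<and>
              is_internal_direct_sum (CB X) I G' S \<and>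
              G = CB_topology X closure_of S))))
     \<and>
     (\<forall>H :: ('a \<Rightarrow> complex) set. closed_ideal X H \<and> nonvanishing X H \<longrightarrow>
        (locally_connected_space (spectrum X H) \<longleftrightarrow>
         (\<forall>G. closed_ideal X G \<and> G \<subseteq> H \<longrightarrow>
           (\<exists>(I :: ('a \<Rightarrow> complex) set set) G' S.
              (\<forall>i\<in>I. closed_ideal X (G' i) \<and> indecomposable_ideal (G' i) (CB X)) \<and>
              is_internal_direct_sum (CB X) I G' S \<and>
              G = CB_topology X closure_of S))))"
  by (intro conjI allI impI; elim conjE; rule locally_connected_spectrum_iff)

end
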